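(* Let $S(\mathbf{G}(V,E),\mathbf{M})$ be a constrained switching system that is linearly connected and such that $V$ contains an unavoidable set $V^*\subseteq V$ all of whose nodes are irreducible. If $\hat\rho(S)=1$, then the system $S$ is bounded.
   Context: A finite set of matrices $\mathbf{M}=\{A_1,\dots,A_N\}\subset\mathbb{R}^{n\times n}$ is given. $\mathbf{G}(V,E)$ is an automaton: a finite, directed, labeled, strongly connected graph with node set $V$ and edge set $E$; an edge is a triple $(v,w,\sigma)$ with source $v\in V$, destination $w\in V$ and label $\sigma\in\{1,\dots,N\}$. Strong connectivity is understood to guarantee that paths of arbitrary length exist (in particular $E\neq\emptyset$). No initial or final nodes are specified. A path is a sequence of consecutive edges; its length $|p|$ is its number of edges. $E^*_{v,w}$ is the set of all paths of length at least 1 from $v$ to $w$. A cycle on $v$ is an element of $E^*_{v,v}$. For a path $p$ of length $T$ with successive edge labels $\sigma(1),\dots,\sigma(T)$, put $A_p=A_{\sigma(T)}\cdots A_{\sigma(1)}$. A (finite or infinite) sequence of labels is accepted by $\mathbf{G}$ if it is the sequence of labels along some path of $\mathbf{G}$. The constrained switching system $S(\mathbf{G},\mathbf{M})$ is $x_{t+1}=A_{\sigma(t)}x_t$, where $\sigma(0),\dots,\sigma(t)$ is accepted by $\mathbf{G}$. With $\|\cdot\|$ the Euclidean norm and its induced matrix norm, its constrained joint spectral radius is $$\hat\rho(S)=\lim_{t\to\infty}\max\left\{\|A_{\sigma(t-1)}\cdots A_{\sigma(0)}\|^{1/t}:\ \sigma(0),\dots,\sigma(t-1)\text{ is accepted by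 }\mathbf{G}\right\}.$$ The system is bounded if there is $K\ge 1$ such that $\|A_{\sigma(t)}\cdots A_{\sigma(0)}\|\le K$ for all $t\ge 0$ and all switching sequences accepted by $\mathbf{G}$. A node $v\in V$ is irreducible if for any linear subspace $\mathcal{X}\subset\mathbb{R}^n$ with $0<\dim\mathcal{X}<n$ there is a cycle $c\in E^*_{v,v}$ with $A_c\mathcal{X}\not\subset\mathcal{X}$. The system is linearly connected if for every pair of nodes $v,w\in V$ there is $p\in E^*_{v,w}$ with $A_p\ne 0$. A subset $V^*\subseteq V$ is unavoidable if every cycle in $\mathbf{G}$ encounters at least one node of $V^*$. *)

theory Defs
  imports "HOL-Analysis.Analysis" "Graph_Theory.Digraph_Component"
begin

type_synonym 'v edge = "'v \<times> 'v \<times> nat"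

definition label :: "'v edge \<Rightarrow> nat" where
  "label e = snd (snd e)"

definition graph_of :: "'v set \<Rightarrow> 'v edge set \<Rightarrow> ('v, 'v edge) pre_digraph" where
  "graph_of V E = \<lparr>verts = V, arcs = E, tail = fst, head = (\<lambda>e. fst (snd e))\<rparr>"

text \<open>
  \<^const>\<open>strongly_connected\<close> uses the reflexive reachability relation, so a single node without
  edges satisfies it. The condition \<open>E \<noteq> {}\<close> excludes this case and thereby ensures that
  paths of every length exist.
\<close>

definition automaton :: "nat \<Rightarrow> 'v set \<Rightarrow> 'v edge set \<Rightarrow> bool" where
  "automaton N V E \<longleftrightarrow>
     fin_digraph (graph_of V E) \<and> strongly_connected (graph_of V E) \<and> E \<noteq> {} \<and>
     (\<forall>e\<in>E. label e \<in> {1..N})"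

text \<open>The set $E^*_{v,w}$ of paths of length at least 1 from $v$ to $w$.\<close>

definition paths :: "'v set \<Rightarrow> 'v edge set \<Rightarrow> 'v \<Rightarrow> 'v \<Rightarrow> 'v edge list set" where
  "paths V E v w = {p. pre_digraph.awalk (graph_of V E) v p w \<and> p \<noteq> []}"

definition accepted :: "'v set \<Rightarrow> 'v edge set \<Rightarrow> nat list \<Rightarrow> bool" where
  "accepted V E \<sigma> \<longleftrightarrow> (\<exists>v p w. pre_digraph.awalk (graph_of V E) v p w \<and> map label p = \<sigma>)"

text \<open>The first letter of the word gives the rightmost factor of the product.\<close>

primrec word_matrix :: "(nat \<Rightarrow> real^'n^'n) \<Rightarrow> nat list \<Rightarrow> real^'n^'n" where
  "word_matrix A [] = mat 1"
| "word_matrix A (s # \<sigma>) = word_matrix A \<sigma> ** A s"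

definition path_matrix :: "(nat \<Rightarrow> real^'n^'n) \<Rightarrow> 'v edge list \<Rightarrow> real^'n^'n" where
  "path_matrix A p = word_matrix A (map label p)"

text \<open>The norm that the type class provides on \<open>real^'n^'n\<close> is the Frobenius norm, not this one.\<close>

definition matrix_norm :: "real^'n^'n \<Rightarrow> real" where
  "matrix_norm B = onorm (\<lambda>x. B *v x)"

definition cjsr :: "'v set \<Rightarrow> 'v edge set \<Rightarrow> (nat \<Rightarrow> real^'n^'n) \<Rightarrow> real" where
  "cjsr V E A =
     lim (\<lambda>t. Max {root t (matrix_norm (word_matrix A \<sigma>)) | \<sigma>. accepted V E \<sigma> \<and> length \<sigma> = t})"

definition bounded_system :: "'v set \<Rightarrow> 'v edge set \<Rightarrow> (nat \<Rightarrow> real^'n^'n) \<Rightarrow> bool" where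
  "bounded_system V E A \<longleftrightarrow>
     (\<exists>K\<ge>1. \<forall>\<sigma>. accepted V E \<sigma> \<and> \<sigma> \<noteq> [] \<longrightarrow> matrix_norm (word_matrix A \<sigma>) \<le> K)"

definition irreducible_node :: "'v set \<Rightarrow> 'v edge set \<Rightarrow> (nat \<Rightarrow> real^'n^'n) \<Rightarrow> 'v \<Rightarrow> bool" where
  "irreducible_node V E A v \<longleftrightarrow>
     (\<forall>X :: (real^'n) set. subspace X \<and> 0 < dim X \<and> dim X < CARD('n) \<longrightarrow>
        (\<exists>c\<in>paths V E v v. \<not> (\<lambda>x. path_matrix A c *v x) ` X \<subseteq> X))"

definition linearly_connected :: "'v set \<Rightarrow> 'v edge set \<Rightarrow> (nat \<Rightarrow> real^'n^'n) \<Rightarrow> bool" where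
  "linearly_connected V E A \<longleftrightarrow>
     (\<forall>v\<in>V. \<forall>w\<in>V. \<exists>p\<in>paths V E v w. path_matrix A p \<noteq> 0)"

definition unavoidable :: "'v set \<Rightarrow> 'v edge set \<Rightarrow> 'v set \<Rightarrow> bool" where
  "unavoidable V E W \<longleftrightarrow>
     W \<subseteq> V \<and>
     (\<forall>v\<in>V. \<forall>c\<in>paths V E v v. set (pre_digraph.awalk_verts (graph_of V E) v c) \<inter> W \<noteq> {})"

end

theory Submission
  imports Defs
begin

text \<open>
  For a node \<open>v\<close> let \<open>K v\<close> be the set of vectors whose trajectories along all walks from \<open>v\<close> stay
  bounded. It is a subspace, and the matrix of a walk from \<open>v\<close> to \<open>w\<close> maps \<open>K v\<close> into \<open>K w\<close>. Hence
  \<open>K v\<close> is invariant under every cycle on \<open>v\<close>, so at an irreducible node it is trivial: zero or the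
  whole space. By linear connectivity the same alternative holds at all irreducible nodes
  simultaneously, since a nonzero matrix of a walk carries a full \<open>K v\<close> onto a nonzero part of \<open>K w\<close>.

  If \<open>K v\<close> is the whole space for every \<open>v\<close> in the unavoidable set \<open>W\<close>, the walks from each such
  node have uniformly bounded matrices. Every walk with at least \<open>card V\<close> edges enters \<open>W\<close> within
  its first \<open>card V\<close> steps, and there are finitely many shorter walks, so all
  walks have bounded matrices (\<open>bounded_system_if_bounded_on_unavoidable\<close>).

  If instead \<open>K v\<close> is zero for every \<open>v\<close> in \<open>W\<close>, each nonzero vector at a node of \<open>W\<close> can be expanded
  beyond any factor, and the expanding walk may be cut at its last visit to \<open>W\<close> at the cost of
  a constant. Compactness of the unit sphere bounds the length of a walk that doubles the norm and
  returns to \<open>W\<close> by some \<open>M\<close> (\<open>uniform_doubling\<close>). Iterating gives walks of unbounded length \<open>t\<close>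
  whose matrices have norm at least \<open>2 powr (t / M)\<close>, so that the joint spectral radius is at
  least \<open>2 powr (1 / M) > 1\<close> (\<open>cjsr_not_one_if_expanding\<close>). To read off a growth rate from the limit
  that defines the joint spectral radius, one needs that this limit exists. This is
  Fekete's lemma for submultiplicative sequences.
\<close>

section \<open>Convergence of the roots of a submultiplicative sequence\<close>

text \<open>
  Split \<open>n = q * m + r\<close> with \<open>r < m\<close>. The factors of length \<open>m\<close> contribute \<open>z ^ (q * m)\<close>,
  and only finitely many values of \<open>r\<close> occur.
\<close>

lemma submultiplicative_exponential_bound:
  fixes a :: "nat \<Rightarrow> real"
  assumes nonneg: "\<And>n. 0 \<le> a n" and submult: "\<And>m n. a (m + n) \<le> a m * a n"
    and m: "0 < m" and z: "0 < z" and am: "a m \<le> z ^ m"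
  shows "\<exists>C>0. \<forall>n. a n \<le> C * z ^ n"
proof -
  define C where "C = 1 + (\<Sum>r<m. a r / z ^ r)"
  have "0 \<le> (\<Sum>r<m. a r / z ^ r)"
    using nonneg z by (intro sum_nonneg) (auto simp: divide_nonneg_pos)
  then have C: "0 < C" by (simp add: C_def)
  have block: "a (q * m + r) \<le> z ^ (q * m) * a r" for q r
  proof (induction q)
    case (Suc q)
    have "a (Suc q * m + r) \<le> a m * a (q * m + r)"
      using submult[of m "q * m + r"] by (simp add: add.assoc)
    also have "\<dots> \<le> z ^ m * (z ^ (q * m) * a r)"
      using Suc am z nonneg by (intro mult_mono) auto
    finally show ?case by (simp add: power_add mult.assoc)
  qed simp
  have small: "a r \<le> C * z ^ r" if "r < m" for r
  proof -
    have "a r / z ^ r \<le> (\<Sum>r<m. a r / z ^ r)"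
      using that nonneg z by (intro member_le_sum) (auto simp: divide_nonneg_pos)
    then have "a r / z ^ r \<le> C" by (simp add: C_def)
    then show ?thesis using z by (simp add: field_simps)
  qed
  have "a n \<le> C * z ^ n" for n
  proof -
    have "a n \<le> z ^ (n div m * m) * a (n mod m)"
      using block[of "n div m" "n mod m"] by simp
    also have "\<dots> \<le> z ^ (n div m * m) * (C * z ^ (n mod m))"
      using small[of "n mod m"] m z by (intro mult_left_mono) auto
    also have "\<dots> = C * z ^ (n div m * m + n mod m)"
      by (simp only: power_add mult.left_commute)
    finally show ?thesis by simp
  qed
  with C show ?thesis by blast
qed

text \<open>
  The limit is the infimum \<open>L\<close> of the roots: once some root is below \<open>z > L\<close>, the exponential bound
  makes all late roots smaller than any number above \<open>z\<close>.
\<close>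

lemma submultiplicative_root_convergent:
  fixes a :: "nat \<Rightarrow> real"
  assumes nonneg: "\<And>n. 0 \<le> a n" and submult: "\<And>m n. a (m + n) \<le> a m * a n"
  shows "convergent (\<lambda>n. root n (a n))"
proof -
  define L where "L = (INF n\<in>{0<..}. root n (a n))"
  have bdd: "bdd_below ((\<lambda>n. root n (a n)) ` {0<..})"
    using nonneg by (intro bdd_belowI[of _ 0]) (auto intro: real_root_ge_zero)
  have L0: "0 \<le> L"
    unfolding L_def using nonneg by (intro cINF_greatest) (auto intro: real_root_ge_zero)
  have "(\<lambda>n. root n (a n)) \<longlonglongrightarrow> L"
  proof (rule order_tendstoI)
    fix y assume "y < L"
    then have "y < root n (a n)" if "0 < n" for n
      using cINF_lower[OF bdd, of n] that unfolding L_def by auto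
    then show "\<forall>\<^sub>F n in sequentially. y < root n (a n)"
      by (intro eventually_mono[OF eventually_gt_at_top[of "0::nat"]])
  next
    fix y assume "L < y"
    then obtain z where z: "L < z" "z < y" using dense by blast
    then have z0: "0 < z" using L0 by simp
    obtain m where m: "0 < m" "root m (a m) < z"
      using z(1) bdd unfolding L_def by (subst (asm) cINF_less_iff) auto
    have "a m = root m (a m) ^ m" using m nonneg by simp
    also have "\<dots> \<le> z ^ m"
      using m nonneg by (intro power_mono) (auto intro: real_root_ge_zero)
    finally obtain C where C: "0 < C" "\<And>n. a n \<le> C * z ^ n"
      using submultiplicative_exponential_bound[OF nonneg submult m(1) z0] by blast
    have le: "root n (a n) \<le> root n C * z" if "0 < n" for n
    proof -
      have "root n (a n) \<le> root n (C * z ^ n)" using C(2) that by simp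
      also have "\<dots> = root n C * z"
        using that z0 by (simp add: real_root_mult real_root_power_cancel)
      finally show ?thesis .
    qed
    have "(\<lambda>n. root n C * z) \<longlonglongrightarrow> 1 * z"
      by (intro tendsto_intros LIMSEQ_root_const C)
    then have "\<forall>\<^sub>F n in sequentially. root n C * z < y"
      using z(2) by (intro order_tendstoD(2)) auto
    then show "\<forall>\<^sub>F n in sequentially. root n (a n) < y"
      using eventually_gt_at_top[of "0::nat"] by eventually_elim (rule le_less_trans[OF le])
  qed
  then show ?thesis by (auto simp: convergent_def)
qed

section \<open>Matrix norms and products along walks\<close>

lemma norm_matrix_vector_le: "norm (B *v x) \<le> matrix_norm B * norm x"
  for B :: "real^'n^'n"
  unfolding matrix_norm_def by (rule onorm) (rule matrix_vector_mul_bounded_linear)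

lemma matrix_norm_le:
  fixes B :: "real^'n^'n"
  assumes "\<And>x. norm (B *v x) \<le> K * norm x"
  shows "matrix_norm B \<le> K"
  unfolding matrix_norm_def using assms by (rule onorm_le)

lemma matrix_norm_nonneg: "0 \<le> matrix_norm B"
  for B :: "real^'n^'n"
  unfolding matrix_norm_def by (rule onorm_pos_le) (rule matrix_vector_mul_bounded_linear)

lemma matrix_norm_mult_le: "matrix_norm (B ** C) \<le> matrix_norm B * matrix_norm C"
  for B C :: "real^'n^'n"
proof (rule matrix_norm_le)
  fix x :: "real^'n"
  have "norm ((B ** C) *v x) \<le> matrix_norm B * norm (C *v x)"
    using norm_matrix_vector_le[of B "C *v x"] by (simp add: matrix_vector_mul_assoc)
  also have "\<dots> \<le> matrix_norm B * (matrix_norm C * norm x)"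
    by (intro mult_left_mono norm_matrix_vector_le matrix_norm_nonneg)
  finally show "norm ((B ** C) *v x) \<le> matrix_norm B * matrix_norm C * norm x"
    by (simp add: mult.assoc)
qed

lemma word_matrix_append: "word_matrix A (\<sigma> @ \<tau>) = word_matrix A \<tau> ** word_matrix A \<sigma>"
  by (induction \<sigma>) (simp_all add: matrix_mul_assoc)

lemma path_matrix_append_vector:
  "path_matrix A (p @ q) *v x = path_matrix A q *v (path_matrix A p *v x)"
  by (simp add: path_matrix_def word_matrix_append matrix_vector_mul_assoc)

lemma path_matrix_Nil: "path_matrix A [] = mat 1"
  by (simp add: path_matrix_def)

locale switching_system =
  fixes N :: nat and V :: "'v set" and E :: "'v edge set" and A :: "nat \<Rightarrow> real^'n^'n"
  assumes automaton: "automaton N V E"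
begin

sublocale fin_digraph "graph_of V E"
  using automaton unfolding automaton_def by blast

lemma verts_graph_of [simp]: "verts (graph_of V E) = V"
  and arcs_graph_of [simp]: "arcs (graph_of V E) = E"
  by (simp_all add: graph_of_def)

lemma short_walks_bounded:
  "\<exists>C\<ge>1. \<forall>p u v. awalk u p v \<longrightarrow> length p \<le> m \<longrightarrow> matrix_norm (path_matrix A p) \<le> C"
proof -
  let ?S = "{p. set p \<subseteq> E \<and> length p \<le> m}"
  have "finite ?S" using finite_arcs by (intro finite_lists_length_le) simp
  then have "bdd_above ((\<lambda>p. matrix_norm (path_matrix A p)) ` ?S)" by simp
  then obtain C where C: "\<And>p. p \<in> ?S \<Longrightarrow> matrix_norm (path_matrix A p) \<le> C"
    by (auto simp: bdd_above_def)
  show ?thesis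
    using C by (intro exI[of _ "max 1 C"]) (force simp: awalk_def le_max_iff_disj)
qed

section \<open>Walks and the unavoidable set\<close>

text \<open>A walk with \<open>card V\<close> edges repeats a node, hence it contains a cycle.\<close>

lemma long_walk_meets_unavoidable:
  assumes W: "unavoidable V E W" and p: "awalk u p v" "card V \<le> length p"
  shows "\<exists>w\<in>W. w \<in> set (awalk_verts u p)"
proof -
  have "\<not> distinct (awalk_verts u p)"
    using length_apath_less[of u p v] p by (auto simp: apath_def)
  then obtain q r s w where d: "p = q @ r @ s" "0 < length r"
      "awalk u q w" "awalk w r w" "awalk w s v"
    using awalk_not_distinct_decomp[OF p(1)] by blast
  then have "w \<in> V" "r \<in> paths V E w w"
    using awalk_hd_in_verts[of w r w] by (auto simp: paths_def)
  then obtain x where x: "x \<in> W" "x \<in> set (awalk_verts w r)"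
    using W by (fastforce simp: unavoidable_def)
  have "set (awalk_verts u p) = set (awalk_verts u q) \<union> set (awalk_verts w (r @ s))"
    using set_awalk_verts_append[of u q w "r @ s" v] d awalk_appendI by blast
  moreover have "set (awalk_verts w (r @ s)) = set (awalk_verts w r) \<union> set (awalk_verts w s)"
    using set_awalk_verts_append[of w r w s v] d by blast
  ultimately show ?thesis using x by blast
qed

lemma early_visit:
  assumes W: "unavoidable V E W" and p: "awalk u p v" "card V \<le> length p"
  obtains q r w where "w \<in> W" "p = q @ r" "length q \<le> card V" "awalk u q w" "awalk w r v"
proof -
  have "awalk u (take (card V) p @ drop (card V) p) v" using p by simp
  then obtain x where x: "awalk u (take (card V) p) x" "awalk x (drop (card V) p) v"
    unfolding awalk_append_iff by blast
  obtain w where w: "w \<in> W" "w \<in> set (awalk_verts u (take (card V) p))"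
    using long_walk_meets_unavoidable[OF W x(1)] p(2) by auto
  obtain q r where qr: "take (card V) p = q @ r" "awalk u q w" "awalk w r x"
    using awalk_decomp[OF x(1) w(2)] by blast
  have eq: "p = q @ (r @ drop (card V) p)"
    using qr(1) by (metis append_take_drop_id append.assoc)
  have len: "length q \<le> card V"
    using arg_cong[OF qr(1), of length] by simp
  show ?thesis
    by (rule that[OF w(1) eq len qr(2) awalk_appendI[OF qr(3) x(2)]])
qed

lemma late_visit:
  assumes W: "unavoidable V E W" and p: "awalk u p v" "card V \<le> length p"
  obtains q r w where "w \<in> W" "p = q @ r" "length r \<le> card V" "awalk u q w" "awalk w r v"
proof -
  define n where "n = length p - card V"
  have "awalk u (take n p @ drop n p) v" using p by simp
  then obtain x where x: "awalk u (take n p) x" "awalk x (drop n p) v"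
    unfolding awalk_append_iff by blast
  have l: "length (drop n p) = card V" using p(2) by (simp add: n_def)
  obtain w where w: "w \<in> W" "w \<in> set (awalk_verts x (drop n p))"
    using long_walk_meets_unavoidable[OF W x(2)] l by auto
  obtain q r where qr: "drop n p = q @ r" "awalk x q w" "awalk w r v"
    using awalk_decomp[OF x(2) w(2)] by blast
  have eq: "p = (take n p @ q) @ r"
    using qr(1) by (metis append_take_drop_id append.assoc)
  have len: "length r \<le> card V"
    using arg_cong[OF qr(1), of length] l by simp
  show ?thesis
    by (rule that[OF w(1) eq len awalk_appendI[OF x(1) qr(2)] qr(3)])
qed

section \<open>The vectors with bounded trajectories\<close>

definition bounded_vectors :: "'v \<Rightarrow> (real^'n) set" where
  "bounded_vectors v = {x. \<exists>B. \<forall>p w. awalk v p w \<longrightarrow> norm (path_matrix A p *v x) \<le> B}"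

lemma subspace_bounded_vectors: "subspace (bounded_vectors v)"
proof (rule subspaceI)
  show "0 \<in> bounded_vectors v" by (auto simp: bounded_vectors_def)
next
  fix x y assume "x \<in> bounded_vectors v" "y \<in> bounded_vectors v"
  then obtain B C where "\<And>p w. awalk v p w \<Longrightarrow> norm (path_matrix A p *v x) \<le> B"
      "\<And>p w. awalk v p w \<Longrightarrow> norm (path_matrix A p *v y) \<le> C"
    unfolding bounded_vectors_def by blast
  then have "norm (path_matrix A p *v (x + y)) \<le> B + C" if "awalk v p w" for p w
    using that unfolding matrix_vector_right_distrib
    by (meson add_mono norm_triangle_le)
  then show "x + y \<in> bounded_vectors v" unfolding bounded_vectors_def by blast
next
  fix c x assume "x \<in> bounded_vectors v"
  then obtain B where "\<And>p w. awalk v p w \<Longrightarrow> norm (path_matrix A p *v x) \<le> B"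
    unfolding bounded_vectors_def by blast
  then have "norm (path_matrix A p *v (c *\<^sub>R x)) \<le> \<bar>c\<bar> * B" if "awalk v p w" for p w
    using that by (simp add: linear_scale[OF matrix_vector_mul_linear] mult_left_mono)
  then show "c *\<^sub>R x \<in> bounded_vectors v" unfolding bounded_vectors_def by blast
qed

lemma bounded_vectors_walk:
  assumes p: "awalk v p w" and x: "x \<in> bounded_vectors v"
  shows "path_matrix A p *v x \<in> bounded_vectors w"
proof -
  obtain B where B: "\<And>q u. awalk v q u \<Longrightarrow> norm (path_matrix A q *v x) \<le> B"
    using x unfolding bounded_vectors_def by blast
  have "norm (path_matrix A q *v (path_matrix A p *v x)) \<le> B" if "awalk w q u" for q u
    using B[OF awalk_appendI[OF p that]] by (simp add: path_matrix_append_vector)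
  then show ?thesis unfolding bounded_vectors_def by blast
qed

lemma bounded_vectors_irreducible:
  assumes "irreducible_node V E A v"
  shows "bounded_vectors v = {0} \<or> bounded_vectors v = UNIV"
proof -
  have "(\<lambda>x. path_matrix A c *v x) ` bounded_vectors v \<subseteq> bounded_vectors v"
    if "c \<in> paths V E v v" for c
    using that bounded_vectors_walk by (auto simp: paths_def)
  then have "dim (bounded_vectors v) = 0 \<or> CARD('n) \<le> dim (bounded_vectors v)"
    using assms subspace_bounded_vectors[of v] unfolding irreducible_node_def
    by (meson gr0I not_le)
  then show ?thesis
  proof
    assume "dim (bounded_vectors v) = 0"
    then show ?thesis
      using subspace_0[OF subspace_bounded_vectors] by (auto simp: dim_eq_0)
  next
    assume "CARD('n) \<le> dim (bounded_vectors v)"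
    then have "dim (bounded_vectors v) = DIM(real^'n)"
      using dim_subset_UNIV[of "bounded_vectors v"] by simp
    then show ?thesis
      using subspace_bounded_vectors span_eq_iff dim_eq_full by metis
  qed
qed

lemma bounded_vectors_linearly_connected:
  assumes lc: "linearly_connected V E A" and vw: "v \<in> V" "w \<in> V"
    and irr: "irreducible_node V E A w" and full: "bounded_vectors v = UNIV"
  shows "bounded_vectors w = UNIV"
proof -
  obtain p where p: "awalk v p w" "path_matrix A p \<noteq> 0"
    using lc vw by (auto simp: linearly_connected_def paths_def)
  obtain x where "path_matrix A p *v x \<noteq> 0"
    using p(2) matrix_eq[of "path_matrix A p" 0] by auto
  moreover have "path_matrix A p *v x \<in> bounded_vectors w"
    using bounded_vectors_walk[OF p(1)] full by simp
  ultimately show ?thesis using bounded_vectors_irreducible[OF irr] by auto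
qed

section \<open>Boundedness\<close>

text \<open>Finitely many bounded trajectories suffice: those of the standard basis vectors.\<close>

lemma walks_bounded_if_bounded_vectors_full:
  assumes full: "bounded_vectors v = UNIV"
  shows "\<exists>K. \<forall>p w. awalk v p w \<longrightarrow> matrix_norm (path_matrix A p) \<le> K"
proof -
  have "\<forall>i. \<exists>B. \<forall>p w. awalk v p w \<longrightarrow> norm (path_matrix A p *v axis i 1) \<le> B"
    using full by (auto simp: bounded_vectors_def)
  then obtain B where B: "\<And>i p w. awalk v p w \<Longrightarrow> norm (path_matrix A p *v axis i 1) \<le> B i"
    by metis
  have "matrix_norm (path_matrix A p) \<le> (\<Sum>i\<in>UNIV. B i)" if p: "awalk v p w" for p w
  proof (rule matrix_norm_le)
    fix x :: "real^'n"
    have "norm (path_matrix A p *v x)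
        = norm (\<Sum>i\<in>UNIV. x $ i *\<^sub>R (path_matrix A p *v axis i 1))"
      by (subst matrix_mult_sum) (simp add: matrix_vector_mult_basis scalar_mult_eq_scaleR)
    also have "\<dots> \<le> (\<Sum>i\<in>UNIV. norm x * B i)"
      using B[OF p] by (intro sum_norm_le) (auto intro!: mult_mono component_le_norm_cart)
    finally show "norm (path_matrix A p *v x) \<le> (\<Sum>i\<in>UNIV. B i) * norm x"
      by (simp add: sum_distrib_left mult.commute)
  qed
  then show ?thesis by blast
qed

text \<open>Cut a long walk at an early visit to \<open>W\<close>. The part before the visit is short.\<close>

lemma bounded_system_if_bounded_on_unavoidable:
  assumes W: "unavoidable V E W" and full: "\<And>v. v \<in> W \<Longrightarrow> bounded_vectors v = UNIV"
  shows "bounded_system V E A"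
proof -
  have "finite W" using W finite_verts finite_subset by (auto simp: unavoidable_def)
  moreover have "\<forall>v\<in>W. \<forall>\<^sub>F K in at_top. \<forall>p w. awalk v p w \<longrightarrow> matrix_norm (path_matrix A p) \<le> K"
  proof
    fix v assume "v \<in> W"
    then obtain K0 where "\<forall>p w. awalk v p w \<longrightarrow> matrix_norm (path_matrix A p) \<le> K0"
      using walks_bounded_if_bounded_vectors_full full by blast
    then show "\<forall>\<^sub>F K in at_top. \<forall>p w. awalk v p w \<longrightarrow> matrix_norm (path_matrix A p) \<le> K"
      unfolding eventually_at_top_linorder by (meson order_trans)
  qed
  ultimately have "\<forall>\<^sub>F K in at_top. \<forall>v\<in>W. \<forall>p w. awalk v p w \<longrightarrow> matrix_norm (path_matrix A p) \<le> K"
    by (rule eventually_ball_finite)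
  then have "\<exists>K\<ge>1. \<forall>v\<in>W. \<forall>p w. awalk v p w \<longrightarrow> matrix_norm (path_matrix A p) \<le> K"
    unfolding eventually_at_top_linorder by (meson max.cobounded1 max.cobounded2)
  then obtain K where K: "1 \<le> K"
      "\<And>v p w. v \<in> W \<Longrightarrow> awalk v p w \<Longrightarrow> matrix_norm (path_matrix A p) \<le> K"
    by blast
  obtain C where C: "1 \<le> C"
      "\<And>p u v. awalk u p v \<Longrightarrow> length p \<le> card V \<Longrightarrow> matrix_norm (path_matrix A p) \<le> C"
    using short_walks_bounded by blast
  have "1 * C \<le> K * C" using C(1) K(1) by (intro mult_right_mono) auto
  then have CK: "C \<le> K * C" "1 \<le> K * C" using C(1) by linarith+
  have "matrix_norm (path_matrix A p) \<le> K * C" if p: "awalk u p v" for u p v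
  proof (cases "length p < card V")
    case True
    then show ?thesis using C(2)[OF p] CK by simp
  next
    case False
    then obtain q r w where d: "w \<in> W" "p = q @ r" "length q \<le> card V" "awalk u q w" "awalk w r v"
      using early_visit[OF W p] by (metis not_less)
    have "matrix_norm (path_matrix A p) \<le> matrix_norm (path_matrix A r) * matrix_norm (path_matrix A q)"
      unfolding d(2) by (simp add: path_matrix_def word_matrix_append matrix_norm_mult_le)
    also have "\<dots> \<le> K * C"
      using K(1) K(2)[OF d(1,5)] C(2)[OF d(4,3)] by (intro mult_mono) (auto simp: matrix_norm_nonneg)
    finally show ?thesis .
  qed
  then have "matrix_norm (word_matrix A \<sigma>) \<le> K * C" if "accepted V E \<sigma>" for \<sigma>
    using that by (auto simp: accepted_def path_matrix_def)
  then show ?thesis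
    using CK(2) unfolding bounded_system_def by blast
qed

section \<open>Expansion\<close>

text \<open>
  The trajectory is unbounded, so some walk expands \<open>x\<close> by more than \<open>2 * C\<close>, where \<open>C\<close> bounds the
  matrices of walks of length at most \<open>card V\<close>. Dropping the part after a late visit to \<open>W\<close> loses
  at most the factor \<open>C\<close>.
\<close>

lemma doubling_walk:
  assumes W: "unavoidable V E W" and v: "bounded_vectors v = {0}" and x: "norm x = 1"
  shows "\<exists>p. \<exists>w\<in>W. awalk v p w \<and> 2 < norm (path_matrix A p *v x)"
proof -
  obtain C where C: "1 \<le> C"
      "\<And>p u v. awalk u p v \<Longrightarrow> length p \<le> card V \<Longrightarrow> matrix_norm (path_matrix A p) \<le> C"
    using short_walks_bounded by blast
  have "x \<noteq> 0" using x by force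
  then have "x \<notin> bounded_vectors v" by (simp add: v)
  then have "\<not> (\<forall>p w. awalk v p w \<longrightarrow> norm (path_matrix A p *v x) \<le> 2 * C)"
    unfolding bounded_vectors_def by blast
  then obtain p w where p: "awalk v p w" "2 * C < norm (path_matrix A p *v x)"
    unfolding not_le[symmetric] by blast
  have "card V \<le> length p"
  proof (rule ccontr)
    assume "\<not> card V \<le> length p"
    then have "matrix_norm (path_matrix A p) \<le> C" using C(2)[OF p(1)] by simp
    then show False using norm_matrix_vector_le[of "path_matrix A p" x] x p(2) C(1) by simp
  qed
  then obtain q r y where d: "y \<in> W" "p = q @ r" "length r \<le> card V" "awalk v q y" "awalk y r w"
    using late_visit[OF W p(1)] by metis
  have "2 * C < norm (path_matrix A r *v (path_matrix A q *v x))"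
    using p(2) unfolding d(2) path_matrix_append_vector .
  also have "\<dots> \<le> matrix_norm (path_matrix A r) * norm (path_matrix A q *v x)"
    by (rule norm_matrix_vector_le)
  also have "\<dots> \<le> C * norm (path_matrix A q *v x)"
    using C(2)[OF d(5,3)] by (rule mult_right_mono) simp
  finally have "2 < norm (path_matrix A q *v x)" using C(1) by simp
  with d show ?thesis by blast
qed

text \<open>
  The unit vectors that a given walk expands by more than \<open>2\<close> form a relatively open set, so finitely
  many walks from each node handle the whole unit sphere.
\<close>

lemma uniform_doubling:
  assumes W: "unavoidable V E W" and zero: "\<And>v. v \<in> W \<Longrightarrow> bounded_vectors v = {0}"
  shows "\<exists>M. \<forall>v\<in>W. \<forall>x. norm x = 1 \<longrightarrow>
    (\<exists>p. \<exists>w\<in>W. awalk v p w \<and> length p \<le> M \<and> 2 < norm (path_matrix A p *v x))"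
    (is "\<exists>M. \<forall>v\<in>W. ?P M v")
proof -
  have "finite W" using W finite_verts finite_subset by (auto simp: unavoidable_def)
  moreover have "\<forall>v\<in>W. \<forall>\<^sub>F M in at_top. ?P M v"
  proof
    fix v assume v: "v \<in> W"
    let ?T = "{p. \<exists>w\<in>W. awalk v p w}"
    let ?U = "\<lambda>p. {x. 2 < norm (path_matrix A p *v x)}"
    have "open (?U p)" for p
      by (intro open_Collect_less continuous_on_const continuous_on_norm
          linear_continuous_on matrix_vector_mul_bounded_linear)
    moreover have "sphere 0 1 \<subseteq> (\<Union>p\<in>?T. ?U p)"
    proof
      fix x :: "real^'n" assume "x \<in> sphere 0 1"
      then show "x \<in> (\<Union>p\<in>?T. ?U p)"
        using doubling_walk[OF W zero[OF v], of x] by auto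
    qed
    ultimately obtain F where F: "F \<subseteq> ?T" "finite F" "sphere 0 1 \<subseteq> (\<Union>p\<in>F. ?U p)"
      using compactE_image[OF compact_sphere[of 0 1], of ?T ?U] by blast
    have "?P M v" if "(\<Sum>p\<in>F. length p) \<le> M" for M
    proof (intro allI impI)
      fix x :: "real^'n" assume "norm x = 1"
      then obtain p where p: "p \<in> F" "2 < norm (path_matrix A p *v x)" using F(3) by auto
      have "length p \<le> (\<Sum>p\<in>F. length p)" using p(1) F(2) by (intro member_le_sum) auto
      with p that F(1) show "\<exists>p. \<exists>w\<in>W. awalk v p w \<and> length p \<le> M \<and> 2 < norm (path_matrix A p *v x)"
        by (blast intro: order_trans)
    qed
    then show "\<forall>\<^sub>F M in at_top. ?P M v"
      unfolding eventually_at_top_linorder by blast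
  qed
  ultimately have "\<forall>\<^sub>F M in at_top. \<forall>v\<in>W. ?P M v" by (rule eventually_ball_finite)
  then show ?thesis unfolding eventually_at_top_linorder by blast
qed

text \<open>
  Each block of the iteration has between \<open>1\<close> and \<open>M\<close> edges. The lower bound makes the lengths
  tend to infinity, the upper one gives the exponential rate.
\<close>

lemma exponential_growth:
  assumes W: "unavoidable V E W" and zero: "\<And>v. v \<in> W \<Longrightarrow> bounded_vectors v = {0}" and v: "v \<in> W"
  shows "\<exists>M>0. \<forall>k. \<exists>p w. awalk v p w \<and> k \<le> length p \<and> length p \<le> k * M \<and>
    2 ^ k \<le> matrix_norm (path_matrix A p)"
proof -
  obtain M where M: "\<And>v x. v \<in> W \<Longrightarrow> norm x = 1 \<Longrightarrow>
      \<exists>p. \<exists>w\<in>W. awalk v p w \<and> length p \<le> M \<and> 2 < norm (path_matrix A p *v x)"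
    using uniform_doubling[OF W zero] by blast
  have step: "\<exists>p. \<exists>w\<in>W. awalk u p w \<and> 1 \<le> length p \<and> length p \<le> M \<and>
      2 * norm y \<le> norm (path_matrix A p *v y)" if u: "u \<in> W" and y: "y \<noteq> 0" for u y
  proof -
    define x where "x = y /\<^sub>R norm y"
    have x: "norm x = 1" "y = norm y *\<^sub>R x" using y by (simp_all add: x_def)
    obtain p w where p: "w \<in> W" "awalk u p w" "length p \<le> M" "2 < norm (path_matrix A p *v x)"
      using M[OF u x(1)] by blast
    have "p \<noteq> []" using p(4) x(1) by (auto simp: path_matrix_Nil)
    moreover have "norm (path_matrix A p *v y) = norm y * norm (path_matrix A p *v x)"
      by (subst x(2)) (simp add: linear_scale[OF matrix_vector_mul_linear])
    then have "2 * norm y \<le> norm (path_matrix A p *v y)"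
      using p(4) mult_left_mono[of 2 "norm (path_matrix A p *v x)" "norm y"]
      by (simp add: mult.commute)
    ultimately show ?thesis using p by (auto simp: Suc_le_eq)
  qed
  \<comment> \<open>Any unit vector can start the iteration.\<close>
  define x :: "real^'n" where "x = axis undefined 1"
  have x: "norm x = 1" by (simp add: x_def)
  have grow: "\<exists>p. \<exists>w\<in>W. awalk v p w \<and> k \<le> length p \<and> length p \<le> k * M \<and>
      2 ^ k \<le> norm (path_matrix A p *v x)" for k
  proof (induction k)
    case 0
    have "awalk v [] v" using v W by (auto simp: awalk_Nil_iff unavoidable_def)
    then show ?case using x v by (intro exI[of _ "[]"]) (auto simp: path_matrix_Nil)
  next
    case (Suc k)
    then obtain p w where p: "w \<in> W" "awalk v p w" "k \<le> length p" "length p \<le> k * M"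
        "2 ^ k \<le> norm (path_matrix A p *v x)" by blast
    have "path_matrix A p *v x \<noteq> 0"
      using p(5) zero_less_power[of "2::real" k] by (metis norm_zero not_less zero_less_numeral)
    then obtain q u where q: "u \<in> W" "awalk w q u" "1 \<le> length q" "length q \<le> M"
        "2 * norm (path_matrix A p *v x) \<le> norm (path_matrix A q *v (path_matrix A p *v x))"
      using step[OF p(1)] by blast
    have "2 ^ Suc k \<le> norm (path_matrix A (p @ q) *v x)"
      using p(5) q(5) by (simp add: path_matrix_append_vector)
    moreover have "awalk v (p @ q) u" using p(2) q(2) by (rule awalk_appendI)
    ultimately show ?case using p q by (intro exI[of _ "p @ q"] bexI[of _ u]) auto
  qed
  have "0 < M" using grow[of 1] by (cases M) auto
  moreover have "\<exists>p w. awalk v p w \<and> k \<le> length p \<and> length p \<le> k * M \<and>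
      2 ^ k \<le> matrix_norm (path_matrix A p)" for k
  proof -
    obtain p w where p: "awalk v p w" "k \<le> length p" "length p \<le> k * M"
        "2 ^ k \<le> norm (path_matrix A p *v x)" using grow[of k] by blast
    then show ?thesis
      using norm_matrix_vector_le[of "path_matrix A p" x] x by force
  qed
  ultimately show ?thesis by blast
qed

section \<open>The joint spectral radius as a limit\<close>

lemma walk_of_length: "v \<in> V \<Longrightarrow> \<exists>p w. awalk v p w \<and> length p = t"
proof (induction t arbitrary: v)
  case 0
  then show ?case by (intro exI[of _ "[]"] exI[of _ v]) (simp add: awalk_Nil_iff)
next
  case (Suc t)
  \<comment> \<open>Strong connectivity and the existence of one edge give every node an outgoing edge.\<close>
  obtain e where e: "e \<in> E" using automaton by (auto simp: automaton_def)
  have "tail (graph_of V E) e \<in> V" using e tail_in_verts[of e] by simp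
  then have "v \<rightarrow>\<^sup>*\<^bsub>graph_of V E\<^esub> tail (graph_of V E) e"
    using Suc.prems automaton by (auto simp: automaton_def strongly_connected_def)
  then obtain p where p: "awalk v p (tail (graph_of V E) e)" unfolding reachable_awalk by blast
  have "\<exists>f\<in>E. tail (graph_of V E) f = v"
  proof (cases p)
    case Nil
    then show ?thesis using p e by (auto simp: awalk_Nil_iff)
  next
    case (Cons f fs)
    then show ?thesis using p by (auto simp: awalk_Cons_iff)
  qed
  then obtain f where f: "f \<in> E" "tail (graph_of V E) f = v" by blast
  obtain q w where "awalk (head (graph_of V E) f) q w" "length q = t"
    using Suc.IH[of "head (graph_of V E) f"] head_in_verts[of f] f by auto
  then show ?case
    using f by (intro exI[of _ "f # q"] exI[of _ w]) (simp add: awalk_Cons_iff)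
qed

definition max_growth :: "nat \<Rightarrow> real" where
  "max_growth t = Max {matrix_norm (word_matrix A \<sigma>) | \<sigma>. accepted V E \<sigma> \<and> length \<sigma> = t}"

lemma accepted_words_finite: "finite {\<sigma>. accepted V E \<sigma> \<and> length \<sigma> = t}"
proof (rule finite_subset)
  show "{\<sigma>. accepted V E \<sigma> \<and> length \<sigma> = t} \<subseteq> {\<sigma>. set \<sigma> \<subseteq> {1..N} \<and> length \<sigma> = t}"
    using automaton by (fastforce simp: accepted_def automaton_def awalk_def)
  show "finite {\<sigma>. set \<sigma> \<subseteq> {1..N} \<and> length \<sigma> = t}"
    by (rule finite_lists_length_eq) simp
qed

lemma accepted_words_nonempty: "\<exists>\<sigma>. accepted V E \<sigma> \<and> length \<sigma> = t"
proof -
  obtain v where "v \<in> V" using automaton by (auto simp: automaton_def strongly_connected_def)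
  then obtain p w where "awalk v p w" "length p = t" using walk_of_length by blast
  then show ?thesis by (intro exI[of _ "map label p"]) (auto simp: accepted_def)
qed

lemma max_growth_ge:
  assumes "accepted V E \<sigma>"
  shows "matrix_norm (word_matrix A \<sigma>) \<le> max_growth (length \<sigma>)"
  unfolding max_growth_def using assms accepted_words_finite
  by (intro Max_ge) (auto simp: setcompr_eq_image)

lemma max_growth_attained:
  obtains \<sigma> where "accepted V E \<sigma>" "length \<sigma> = t" "max_growth t = matrix_norm (word_matrix A \<sigma>)"
proof -
  have "max_growth t \<in> {matrix_norm (word_matrix A \<sigma>) | \<sigma>. accepted V E \<sigma> \<and> length \<sigma> = t}"
    unfolding max_growth_def using accepted_words_finite accepted_words_nonempty
    by (intro Max_in) (auto simp: setcompr_eq_image)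
  then show ?thesis using that by blast
qed

lemma max_growth_nonneg: "0 \<le> max_growth t"
  by (metis max_growth_attained matrix_norm_nonneg)

lemma max_growth_submultiplicative: "max_growth (s + t) \<le> max_growth s * max_growth t"
proof -
  obtain \<sigma> where \<sigma>: "accepted V E \<sigma>" "length \<sigma> = s + t"
      "max_growth (s + t) = matrix_norm (word_matrix A \<sigma>)"
    by (rule max_growth_attained)
  obtain v p w where p: "awalk v p w" "map label p = \<sigma>" using \<sigma>(1) by (auto simp: accepted_def)
  have "awalk v (take s p @ drop s p) w" using p by simp
  then have "accepted V E (take s \<sigma>)" "accepted V E (drop s \<sigma>)"
    unfolding awalk_append_iff accepted_def p(2)[symmetric] by (metis take_map, metis drop_map)
  from max_growth_ge[OF this(1)] max_growth_ge[OF this(2)]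
  have le: "matrix_norm (word_matrix A (take s \<sigma>)) \<le> max_growth s"
      "matrix_norm (word_matrix A (drop s \<sigma>)) \<le> max_growth t"
    using \<sigma>(2) by simp_all
  have "max_growth (s + t) = matrix_norm (word_matrix A (drop s \<sigma>) ** word_matrix A (take s \<sigma>))"
    unfolding \<sigma>(3) word_matrix_append[symmetric] by simp
  also have "\<dots> \<le> matrix_norm (word_matrix A (drop s \<sigma>)) * matrix_norm (word_matrix A (take s \<sigma>))"
    by (rule matrix_norm_mult_le)
  also have "\<dots> \<le> max_growth t * max_growth s"
    using le by (intro mult_mono) (auto simp: matrix_norm_nonneg max_growth_nonneg)
  finally show ?thesis by (simp add: mult.commute)
qed

lemma root_max_growth_tendsto_cjsr: "(\<lambda>t. root t (max_growth t)) \<longlonglongrightarrow> cjsr V E A"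
proof -
  have "root t (max_growth t)
      = Max {root t (matrix_norm (word_matrix A \<sigma>)) | \<sigma>. accepted V E \<sigma> \<and> length \<sigma> = t}" for t
  proof -
    let ?S = "{\<sigma>. accepted V E \<sigma> \<and> length \<sigma> = t}"
    have "mono (root t)"
      by (cases "t = 0") (auto intro!: monoI)
    then have "root t (Max ((\<lambda>\<sigma>. matrix_norm (word_matrix A \<sigma>)) ` ?S))
        = Max (root t ` (\<lambda>\<sigma>. matrix_norm (word_matrix A \<sigma>)) ` ?S)"
      using accepted_words_finite accepted_words_nonempty by (intro mono_Max_commute) auto
    then show ?thesis by (simp add: max_growth_def setcompr_eq_image image_image)
  qed
  then have "cjsr V E A = lim (\<lambda>t. root t (max_growth t))" by (simp add: cjsr_def)
  moreover have "convergent (\<lambda>t. root t (max_growth t))"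
    by (rule submultiplicative_root_convergent)
       (rule max_growth_nonneg, rule max_growth_submultiplicative)
  ultimately show ?thesis by (simp add: convergent_LIMSEQ_iff)
qed

text \<open>
  If the limit were \<open>1\<close>, all long walks would grow at a rate below \<open>root M (3 / 2) > 1\<close>,
  against the growth by \<open>2 ^ k\<close> along walks of length at most \<open>k * M\<close>.
\<close>

lemma cjsr_not_one_if_expanding:
  assumes W: "unavoidable V E W" and zero: "\<And>v. v \<in> W \<Longrightarrow> bounded_vectors v = {0}" and v: "v \<in> W"
  shows "cjsr V E A \<noteq> 1"
proof
  assume "cjsr V E A = 1"
  then have lim: "(\<lambda>t. root t (max_growth t)) \<longlonglongrightarrow> 1" using root_max_growth_tendsto_cjsr by simp
  obtain M where M: "0 < M" "\<And>k. \<exists>p w. awalk v p w \<and> k \<le> length p \<and> length p \<le> k * M \<and>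
      2 ^ k \<le> matrix_norm (path_matrix A p)"
    using exponential_growth[OF W zero v] by blast
  define z where "z = root M (3 / 2)"
  have z: "1 < z" "z ^ M = 3 / 2" using M(1) by (simp_all add: z_def)
  obtain T where T: "\<And>t. T \<le> t \<Longrightarrow> root t (max_growth t) < z"
    using order_tendstoD(2)[OF lim z(1)] by (auto simp: eventually_at_top_linorder)
  obtain p w where p: "awalk v p w" "Suc T \<le> length p" "length p \<le> Suc T * M"
      "2 ^ Suc T \<le> matrix_norm (path_matrix A p)"
    using M(2) by blast
  define t where "t = length p"
  have t: "0 < t" using p(2) unfolding t_def by linarith
  have "(2::real) ^ Suc T \<le> max_growth t"
    using max_growth_ge[of "map label p"] p by (force simp: accepted_def path_matrix_def t_def)
  also have "\<dots> = root t (max_growth t) ^ t"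
    by (rule real_root_pow_pos2[OF t max_growth_nonneg, symmetric])
  also have "\<dots> \<le> z ^ t"
    using T[of t] p(2) max_growth_nonneg by (intro power_mono) (auto simp: t_def intro: real_root_ge_zero)
  also have "\<dots> \<le> z ^ (M * Suc T)"
    using z(1) p(3) by (intro power_increasing) (auto simp: t_def mult.commute)
  also have "\<dots> = (3 / 2) ^ Suc T" by (simp only: power_mult z(2))
  also have "\<dots> < 2 ^ Suc T" by (rule power_strict_mono) auto
  finally show False by simp
qed

end

section \<open>Boundedness of linearly connected systems\<close>

theorem theorem2p2:
  fixes A :: "nat \<Rightarrow> real^'n^'n"
    and N :: nat
    and V :: "'v set"
    and E :: "'v edge set"
    and W :: "'v set"
  assumes "automaton N V E"
    and "linearly_connected V E A"
    and "unavoidable V E W"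
    and "\<And>v. v \<in> W \<Longrightarrow> irreducible_node V E A v"
    and "cjsr V E A = 1"
  shows "bounded_system V E A"
proof -
  interpret switching_system N V E A by unfold_locales (rule assms(1))
  have WV: "W \<subseteq> V" using assms(3) by (simp add: unavoidable_def)
  show ?thesis
  proof (cases "\<forall>v\<in>W. bounded_vectors v = UNIV")
    case True
    then show ?thesis using bounded_system_if_bounded_on_unavoidable[OF assms(3)] by blast
  next
    case False
    then obtain v where v: "v \<in> W" "bounded_vectors v \<noteq> UNIV" by blast
    have "bounded_vectors w = {0}" if w: "w \<in> W" for w
      using bounded_vectors_linearly_connected[OF assms(2) _ _ assms(4)[OF v(1)], of w]
        bounded_vectors_irreducible[OF assms(4)[OF w]] v w WV by blast
    then show ?thesis
      using cjsr_not_one_if_expanding[OF assms(3) _ v(1)] assms(5) by blast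
  qed
qed

end
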